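(* Let $\Gamma=(G,\sigma)$ be a connected signed graph, let $uv$ be a non-pendant cut edge of $\Gamma$, and let $\Gamma'=\alpha(\Gamma,uv)$ be the $\alpha$-transform of $\Gamma$ on $uv$. Then $\lambda(\Gamma')\ge\lambda(\Gamma)$.
   Context: A signed graph $\Gamma=(G,\sigma)$ is a finite simple graph $G$ with a map $\sigma:E(G)\to\{+1,-1\}$. Its adjacency matrix $A(\Gamma)$ has $(u,v)$ entry $\sigma(uv)$ if $uv\in E(G)$ and $0$ otherwise; the index $\lambda(\Gamma)$ is the largest eigenvalue of $A(\Gamma)$. A cut edge is an edge whose deletion disconnects the graph. $\alpha$-transform: let $\Gamma$ be a connected signed graph and $uv$ a non-pendant edge (neither end has degree 1) which is not in any triangle. Let $N_\Gamma(v)\setminus\{u\}=\{v_1,\dots,v_d\}$ with $d\ge 1$. Then $$\alpha(\Gamma,uv)=\Gamma-vv_1-\cdots-vv_d+uv_1+\cdots+uv_d,$$ where all edges retain their signs (the new edge $uv_i$ has sign $\sigma(vv_i)$; the edge $uv$ is kept with its sign). *)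

theory Defs
  imports "HOL-Analysis.Analysis"
begin

text \<open>
  Graphs live on a fixed finite vertex type, all of whose elements are vertices; finiteness
  comes from the class \<open>finite\<close>. Values of \<open>sign\<close> on sets that are not edges are irrelevant.
\<close>

record 'v sgraph =
  edges :: "'v set set"
  sign :: "'v set \<Rightarrow> int"

definition signed_graph :: "'v sgraph \<Rightarrow> bool" where
  "signed_graph \<Gamma> \<longleftrightarrow>
     (\<forall>e\<in>edges \<Gamma>. card e = 2) \<and> (\<forall>e\<in>edges \<Gamma>. sign \<Gamma> e \<in> {1, -1})"

definition neighbours :: "'v sgraph \<Rightarrow> 'v \<Rightarrow> 'v set" where
  "neighbours \<Gamma> v = {w. {v, w} \<in> edges \<Gamma>}"

definition vdegree :: "'v sgraph \<Rightarrow> 'v \<Rightarrow> nat" where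
  "vdegree \<Gamma> v = card (neighbours \<Gamma> v)"

definition graph_connected :: "'v sgraph \<Rightarrow> bool" where
  "graph_connected \<Gamma> \<longleftrightarrow> (\<forall>x y. (x, y) \<in> {(a, b). {a, b} \<in> edges \<Gamma>}\<^sup>*)"

definition delete_edge :: "'v sgraph \<Rightarrow> 'v set \<Rightarrow> 'v sgraph" where
  "delete_edge \<Gamma> e = \<Gamma>\<lparr>edges := edges \<Gamma> - {e}\<rparr>"

text \<open>Meant for connected graphs, where losing connectedness is the effect of the deletion.\<close>

definition cut_edge :: "'v sgraph \<Rightarrow> 'v set \<Rightarrow> bool" where
  "cut_edge \<Gamma> e \<longleftrightarrow> e \<in> edges \<Gamma> \<and> \<not> graph_connected (delete_edge \<Gamma> e)"

definition non_pendant_edge :: "'v sgraph \<Rightarrow> 'v set \<Rightarrow> bool" where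
  "non_pendant_edge \<Gamma> e \<longleftrightarrow> e \<in> edges \<Gamma> \<and> (\<forall>x\<in>e. vdegree \<Gamma> x \<noteq> 1)"

definition adjacency_matrix :: "('v::finite) sgraph \<Rightarrow> real ^ 'v ^ 'v" where
  "adjacency_matrix \<Gamma> =
     (\<chi> u v. if {u, v} \<in> edges \<Gamma> then real_of_int (sign \<Gamma> {u, v}) else 0)"

definition is_eigenvalue :: "real ^ 'v ^ ('v::finite) \<Rightarrow> real \<Rightarrow> bool" where
  "is_eigenvalue A k \<longleftrightarrow> (\<exists>x. x \<noteq> 0 \<and> A *v x = k *\<^sub>R x)"

text \<open>
  Adjacency matrices of signed graphs are real symmetric, so their spectrum is a finite nonempty
  set of reals and the maximum is attained.
\<close>

definition index :: "('v::finite) sgraph \<Rightarrow> real" where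
  "index \<Gamma> = Max {k. is_eigenvalue (adjacency_matrix \<Gamma>) k}"

text \<open>
  The transform is intended for an edge \<open>uv\<close> of a connected signed graph that is neither pendant
  nor in a triangle (a cut edge is never in a triangle). The edges \<open>vw\<close> with \<open>w\<close> in
  \<open>neighbours \<Gamma> v - {u}\<close> are replaced by \<open>uw\<close>. For a new edge \<open>e = {u, w}\<close> the set
  \<open>insert v (e - {u})\<close> is \<open>{v, w}\<close>, the edge whose sign it inherits.
\<close>

definition alpha_transform :: "'v sgraph \<Rightarrow> 'v \<Rightarrow> 'v \<Rightarrow> 'v sgraph" where
  "alpha_transform \<Gamma> u v =
     (let old = (\<lambda>w. {v, w}) ` (neighbours \<Gamma> v - {u});
          new = (\<lambda>w. {u, w}) ` (neighbours \<Gamma> v - {u})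
      in \<Gamma>\<lparr>edges := (edges \<Gamma> - old) \<union> new,
            sign := (\<lambda>e. if e \<in> new then sign \<Gamma> (insert v (e - {u})) else sign \<Gamma> e)\<rparr>)"

end

theory Submission
  imports Defs
begin

text \<open>
  By the Rayleigh principle it suffices to turn a top eigenvector \<open>x\<close> of \<open>\<Gamma>\<close> into a vector \<open>y\<close>
  of the same norm whose quadratic form under \<open>\<Gamma>'\<close> is at least as large. Deleting the cut edge
  \<open>uv\<close> separates the side of \<open>u\<close> from the side of \<open>v\<close>, so flipping the sign of \<open>x\<close> on a whole side
  (apart from \<open>u\<close> and \<open>v\<close>) preserves all contributions not involving \<open>u\<close> or \<open>v\<close>. Put the larger of
  \<open>\<bar>x\<^sub>u\<bar>\<close>, \<open>\<bar>x\<^sub>v\<bar>\<close> at \<open>u\<close>, which takes over the neighbours of both, the smaller one at \<open>v\<close>, and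
  choose the sign of \<open>y\<^sub>v\<close> and of the two sides so that all remaining contributions are nonnegative.
\<close>

section \<open>Rayleigh principle for real symmetric matrices\<close>

lemma symmetric_matrix_inner:
  fixes A :: "real ^ 'n ^ 'n::finite"
  assumes "transpose A = A"
  shows "x \<bullet> (A *v y) = (A *v x) \<bullet> y"
  by (metis assms dot_lmul_matrix vector_transpose_matrix)

text \<open>Eigenvectors for distinct eigenvalues are orthogonal, hence independent, so the
  dimension bounds their number. This gives \<open>Max\<close> over the spectrum its
  meaning.\<close>

lemma finite_eigenvalues_symmetric:
  fixes A :: "real ^ 'n ^ 'n::finite"
  assumes "transpose A = A"
  shows "finite {k. is_eigenvalue A k}"
proof -
  define ev where "ev k = (SOME x. x \<noteq> 0 \<and> A *v x = k *\<^sub>R x)" for k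
  let ?K = "{k. is_eigenvalue A k}"
  have ev: "ev k \<noteq> 0" "A *v ev k = k *\<^sub>R ev k" if "k \<in> ?K" for k
    using someI_ex[of "\<lambda>x. x \<noteq> 0 \<and> A *v x = k *\<^sub>R x"] that
    unfolding ev_def is_eigenvalue_def by auto
  have orth: "orthogonal (ev k) (ev l)" if "k \<in> ?K" "l \<in> ?K" "k \<noteq> l" for k l
  proof -
    have "l * (ev k \<bullet> ev l) = k * (ev k \<bullet> ev l)"
      using symmetric_matrix_inner[OF assms, of "ev k" "ev l"] ev that by simp
    then show ?thesis
      using that by (simp add: orthogonal_def)
  qed
  have inj: "inj_on ev ?K"
    using orth ev(1) by (metis inj_onI orthogonal_self)
  have "pairwise orthogonal (ev ` ?K)"
    using orth by (auto simp: pairwise_def)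
  then have "independent (ev ` ?K)"
    by (rule pairwise_orthogonal_independent) (use ev(1) in auto)
  then show ?thesis
    using independent_bound finite_imageD inj by blast
qed

text \<open>If \<open>y = B *v z\<close> were nonzero, the form at \<open>z - t *\<^sub>R y\<close>
  would be \<open>t\<^sup>2 * c - 2 * t * a\<close> with \<open>a > 0\<close>, which is negative for
  small positive \<open>t\<close>.\<close>

lemma psd_isotropic_imp_kernel:
  fixes B :: "real ^ 'n ^ 'n::finite"
  assumes sym: "transpose B = B"
    and psd: "\<And>x. 0 \<le> x \<bullet> (B *v x)"
    and z: "z \<bullet> (B *v z) = 0"
  shows "B *v z = 0"
proof (rule ccontr)
  define y where "y = B *v z"
  define a where "a = y \<bullet> y"
  define c where "c = y \<bullet> (B *v y)"
  assume "B *v z \<noteq> 0"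
  then have a: "a > 0" by (simp add: a_def y_def)
  have c: "c \<ge> 0" using psd by (simp add: c_def)
  have exp: "0 \<le> t\<^sup>2 * c - 2 * t * a" for t :: real
  proof -
    have "z \<bullet> (B *v y) = a"
      using symmetric_matrix_inner[OF sym, of z y] by (simp add: a_def y_def)
    then have "(z - t *\<^sub>R y) \<bullet> (B *v (z - t *\<^sub>R y)) = t\<^sup>2 * c - 2 * t * a"
      using z unfolding matrix_vector_mult_diff_distrib matrix_vector_mult_scaleR
      by (simp add: inner_diff_left inner_diff_right c_def a_def flip: y_def)
         (simp add: power2_eq_square algebra_simps)
    then show ?thesis using psd by metis
  qed
  \<comment> \<open>The summand 1 covers \<open>c = 0\<close>; this \<open>t\<close> is small enough
    for \<open>t * c \<le> a < 2 * a\<close>.\<close>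
  define t where "t = a / (c + 1)"
  have "t > 0" using a c by (simp add: t_def)
  moreover have "t * c \<le> a" using a c by (simp add: t_def field_simps)
  ultimately have "t * (t * c - 2 * a) < 0"
    using a by (intro mult_pos_neg) auto
  then show False using exp[of t] by (simp add: power2_eq_square algebra_simps)
qed

text \<open>By compactness the form attains a maximum \<open>M\<close> on the unit sphere, at
  \<open>z\<close> say. Then \<open>M *\<^sub>R mat 1 - A\<close> is positive semidefinite and
  isotropic at \<open>z\<close>, so \<open>z\<close> is an eigenvector for \<open>M\<close>, and
  \<open>M \<le> m\<close>.\<close>

lemma Max_eigenvalue_symmetric:
  fixes A :: "real ^ 'n ^ 'n::finite"
  assumes sym: "transpose A = A"
  defines "m \<equiv> Max {k. is_eigenvalue A k}"
  shows "is_eigenvalue A m" and "x \<bullet> (A *v x) \<le> m * (x \<bullet> x)"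
proof -
  let ?S = "sphere (0 :: real ^ 'n) 1"
  obtain e :: "real ^ 'n" where "norm e = 1"
    using vector_choose_size[of 1] by auto
  then have ne: "?S \<noteq> {}" by auto
  have "continuous_on ?S (\<lambda>x. x \<bullet> (A *v x))"
    by (intro continuous_intros linear_continuous_on matrix_vector_mul_bounded_linear)
  then obtain z where z: "z \<in> ?S" "\<And>y. y \<in> ?S \<Longrightarrow> y \<bullet> (A *v y) \<le> z \<bullet> (A *v z)"
    using continuous_attains_sup[OF compact_sphere ne] by blast
  define M where "M = z \<bullet> (A *v z)"
  have ray: "y \<bullet> (A *v y) \<le> M * (y \<bullet> y)" for y
  proof (cases "y = 0")
    case False
    then have "(y /\<^sub>R norm y) \<bullet> (A *v (y /\<^sub>R norm y)) \<le> M"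
      using z(2)[of "y /\<^sub>R norm y"] by (simp add: M_def)
    then have "y \<bullet> (A *v y) / (norm y)\<^sup>2 \<le> M"
      by (simp add: matrix_vector_mult_scaleR power2_eq_square divide_inverse mult_ac)
    then show ?thesis
      using False by (simp add: field_simps dot_square_norm)
  qed simp
  define B where "B = M *\<^sub>R mat 1 - A"
  have Bv: "B *v y = M *\<^sub>R y - A *v y" for y
    by (simp add: B_def matrix_vector_mult_diff_rdistrib scaleR_matrix_vector_assoc[symmetric])
  have "transpose B = B"
    using sym by (simp add: B_def transpose_def vec_eq_iff mat_def)
  moreover have "0 \<le> y \<bullet> (B *v y)" for y
    using ray[of y] by (simp add: Bv inner_diff_right)
  moreover have "z \<bullet> (B *v z) = 0"
    using z(1) by (simp add: Bv inner_diff_right M_def dot_square_norm)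
  ultimately have "B *v z = 0" by (rule psd_isotropic_imp_kernel)
  then have M: "is_eigenvalue A M"
    using z(1) unfolding is_eigenvalue_def Bv by (intro exI[of _ z]) auto
  have fin: "finite {k. is_eigenvalue A k}"
    by (rule finite_eigenvalues_symmetric[OF sym])
  show "is_eigenvalue A m"
    using Max_in[OF fin] M unfolding m_def by auto
  have "M \<le> m"
    using Max_ge[OF fin] M unfolding m_def by auto
  then show "x \<bullet> (A *v x) \<le> m * (x \<bullet> x)"
    using ray[of x] mult_right_mono[of M m "x \<bullet> x"] by simp
qed

lemma transpose_adjacency_matrix [simp]: "transpose (adjacency_matrix \<Gamma>) = adjacency_matrix \<Gamma>"
  by (simp add: transpose_def adjacency_matrix_def vec_eq_iff insert_commute)

text \<open>At an eigenvector for \<open>index \<Gamma>\<close> the form equals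
  \<open>index \<Gamma> * (x \<bullet> x)\<close>, and the form of \<Gamma>' at \<open>y\<close> is
  at most \<open>index \<Gamma>' * (y \<bullet> y)\<close>.\<close>

lemma index_mono_rayleigh:
  fixes \<Gamma> \<Gamma>' :: "('v::finite) sgraph"
  assumes "\<And>x. \<exists>y. y \<bullet> y = x \<bullet> x \<and>
    x \<bullet> (adjacency_matrix \<Gamma> *v x) \<le> y \<bullet> (adjacency_matrix \<Gamma>' *v y)"
  shows "index \<Gamma> \<le> index \<Gamma>'"
proof -
  obtain x where x: "x \<noteq> 0" "adjacency_matrix \<Gamma> *v x = index \<Gamma> *\<^sub>R x"
    using Max_eigenvalue_symmetric(1)[of "adjacency_matrix \<Gamma>"]
    by (auto simp: is_eigenvalue_def index_def)
  obtain y where y: "y \<bullet> y = x \<bullet> x"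
    "x \<bullet> (adjacency_matrix \<Gamma> *v x) \<le> y \<bullet> (adjacency_matrix \<Gamma>' *v y)"
    using assms by blast
  have "index \<Gamma> * (x \<bullet> x) \<le> y \<bullet> (adjacency_matrix \<Gamma>' *v y)"
    using y(2) x(2) by simp
  also have "\<dots> \<le> index \<Gamma>' * (x \<bullet> x)"
    using Max_eigenvalue_symmetric(2)[of "adjacency_matrix \<Gamma>'" y] y(1) by (simp add: index_def)
  finally show ?thesis using x(1) by simp
qed

section \<open>The quadratic form with two coordinates split off\<close>

lemma sum_UNIV_split2:
  fixes f :: "'v::finite \<Rightarrow> real"
  assumes "u \<noteq> v"
  shows "sum f UNIV = f u + f v + sum f (- {u, v})"
proof -
  have "sum f UNIV = sum f {u, v} + sum f (- {u, v})"
    by (metis Compl_partition Compl_disjoint finite_code sum.union_disjoint)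
  then show ?thesis using assms by simp
qed

lemma quadratic_form_split2:
  fixes B :: "real ^ 'v ^ 'v::finite"
  assumes "u \<noteq> v" and sym: "transpose B = B" and diag: "B $ u $ u = 0" "B $ v $ v = 0"
  shows "x \<bullet> (B *v x) =
      (\<Sum>a\<in>-{u, v}. \<Sum>b\<in>-{u, v}. B $ a $ b * x $ a * x $ b)
      + 2 * (B $ u $ v * x $ u * x $ v
             + x $ u * (\<Sum>b\<in>-{u, v}. B $ u $ b * x $ b)
             + x $ v * (\<Sum>b\<in>-{u, v}. B $ v $ b * x $ b))"
proof -
  have sym': "B $ a $ b = B $ b $ a" for a b
    using sym by (simp add: transpose_def vec_eq_iff)
  have s: "(\<Sum>a\<in>-{u, v}. x $ a * (B $ a $ c * x $ c)) = x $ c * (\<Sum>b\<in>-{u, v}. B $ c $ b * x $ b)" for c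
    unfolding sum_distrib_left by (intro sum.cong refl) (simp add: sym'[of _ c])
  have "x \<bullet> (B *v x) = (\<Sum>a\<in>UNIV. x $ a * (\<Sum>b\<in>UNIV. B $ a $ b * x $ b))"
    by (simp add: inner_vec_def matrix_vector_mult_def)
  then show ?thesis
    unfolding sum_UNIV_split2[OF \<open>u \<noteq> v\<close>]
    by (simp add: diag distrib_left sum.distrib s sym'[of v u])
       (simp add: sum_distrib_left mult_ac)
qed

lemma exists_sign_mult_abs: "\<exists>e::real. e * e = 1 \<and> e * s = \<bar>s\<bar>"
  by (cases "s \<ge> 0") (auto intro: exI[of _ 1] exI[of _ "-1"])

text \<open>Here \<open>p\<close> and \<open>q\<close> stand for the entries of the vector at
  \<open>u\<close> and \<open>v\<close>, \<open>w\<close> for the sign of \<open>uv\<close>,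
  \<open>S\<close> and \<open>T\<close> for the weighted sums over the other neighbours of
  \<open>u\<close> and \<open>v\<close>, and \<open>e\<close>, \<open>d\<close> for the signs given
  to the two sides.\<close>

lemma exists_dominating_pair:
  fixes w p q S T :: real
  shows "\<exists>p' q' e d. e * e = 1 \<and> d * d = 1 \<and> p' * p' + q' * q' = p * p + q * q \<and>
    w * p * q + p * S + q * T \<le> w * p' * q' + p' * (e * S + d * T)"
proof -
  define m where "m = max \<bar>p\<bar> \<bar>q\<bar>"
  define n where "n = min \<bar>p\<bar> \<bar>q\<bar>"
  obtain e where e: "e * e = 1" "e * S = \<bar>S\<bar>" using exists_sign_mult_abs by blast
  obtain d where d: "d * d = 1" "d * T = \<bar>T\<bar>" using exists_sign_mult_abs by blast
  \<comment> \<open>The sign \<open>c\<close> is put on the smaller entry \<open>n\<close> so that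
    the term of \<open>uv\<close> becomes \<open>\<bar>w\<bar> * (m * n)\<close>.\<close>
  obtain c where c: "c * c = 1" "c * w = \<bar>w\<bar>" using exists_sign_mult_abs by blast
  have "m * m + n * n = p * p + q * q"
    by (auto simp: m_def n_def max_def min_def simp flip: power2_eq_square)
  then have "m * m + (c * n) * (c * n) = p * p + q * q"
    using c(1) by (metis mult.assoc mult.commute mult_1)
  moreover have "w * p * q + p * S + q * T \<le> w * m * (c * n) + m * (e * S + d * T)"
  proof -
    have "m * n = \<bar>p\<bar> * \<bar>q\<bar>" by (auto simp: m_def n_def max_def min_def)
    then have "w * p * q \<le> \<bar>w\<bar> * (m * n)"
      using abs_ge_self[of "w * p * q"] by (simp add: abs_mult mult.assoc)
    also have "\<dots> = w * m * (c * n)" by (simp add: mult_ac flip: c(2))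
    finally have "w * p * q \<le> w * m * (c * n)" .
    moreover have "p * S \<le> m * \<bar>S\<bar>"
      using abs_ge_self[of "p * S"] mult_right_mono[of "\<bar>p\<bar>" m "\<bar>S\<bar>"]
      by (simp add: abs_mult m_def)
    moreover have "q * T \<le> m * \<bar>T\<bar>"
      using abs_ge_self[of "q * T"] mult_right_mono[of "\<bar>q\<bar>" m "\<bar>T\<bar>"]
      by (simp add: abs_mult m_def)
    ultimately show ?thesis unfolding e(2) d(2) distrib_left by linarith
  qed
  ultimately show ?thesis using e(1) d(1) by blast
qed

section \<open>Cut edges and the entries of the transformed matrix\<close>

text \<open>\<open>C\<close> is the component of \<open>v\<close> after the deletion. If it
  contained \<open>u\<close>, a walk between the ends could replace \<open>uv\<close> everywhere,
  and the graph would stay connected.\<close>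

lemma cut_edge_sides:
  assumes conn: "graph_connected \<Gamma>" and cut: "cut_edge \<Gamma> {u, v}"
  obtains C where "v \<in> C" "u \<notin> C"
    "\<And>a b. {a, b} \<in> edges \<Gamma> \<Longrightarrow> {a, b} \<noteq> {u, v} \<Longrightarrow> a \<in> C \<longleftrightarrow> b \<in> C"
proof -
  define r where "r = {(a, b). {a, b} \<in> edges (delete_edge \<Gamma> {u, v})}"
  have sym: "sym (r\<^sup>*)"
    by (intro sym_rtrancl symI) (simp add: r_def insert_commute)
  define C where "C = {b. (v, b) \<in> r\<^sup>*}"
  have step: "a \<in> C \<longleftrightarrow> b \<in> C" if "{a, b} \<in> edges \<Gamma>" "{a, b} \<noteq> {u, v}" for a b
  proof -
    have "(a, b) \<in> r" "(b, a) \<in> r"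
      using that by (auto simp: r_def delete_edge_def insert_commute)
    then show ?thesis unfolding C_def by (auto intro: rtrancl_into_rtrancl)
  qed
  have "u \<notin> C"
  proof
    assume "u \<in> C"
    then have vu: "(v, u) \<in> r\<^sup>*" by (simp add: C_def)
    then have uv: "(u, v) \<in> r\<^sup>*" using sym by (metis symD)
    have "{(a, b). {a, b} \<in> edges \<Gamma>} \<subseteq> r\<^sup>*"
    proof clarify
      fix a b assume ab: "{a, b} \<in> edges \<Gamma>"
      show "(a, b) \<in> r\<^sup>*"
      proof (cases "{a, b} = {u, v}")
        case True
        then show ?thesis using uv vu by (auto simp: doubleton_eq_iff)
      next
        case False
        then show ?thesis using ab by (auto simp: r_def delete_edge_def)
      qed
    qed
    then have "{(a, b). {a, b} \<in> edges \<Gamma>}\<^sup>* \<subseteq> r\<^sup>*"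
      by (metis rtrancl_mono rtrancl_idemp)
    then have "graph_connected (delete_edge \<Gamma> {u, v})"
      using conn unfolding graph_connected_def r_def by blast
    then show False using cut by (simp add: cut_edge_def)
  qed
  moreover have "v \<in> C" by (simp add: C_def)
  ultimately show ?thesis using that step by blast
qed

text \<open>As \<open>u\<close> and \<open>v\<close> have no common neighbour, no new edge at
  \<open>u\<close> coincides with an old one, so outside \<open>u\<close> and \<open>v\<close> the
  row of \<open>v\<close> is simply added to that of \<open>u\<close>.\<close>

lemma adjacency_alpha_transform:
  fixes \<Gamma> :: "('v::finite) sgraph"
  assumes sg: "signed_graph \<Gamma>" and uv: "{u, v} \<in> edges \<Gamma>"
    and disj: "neighbours \<Gamma> u \<inter> neighbours \<Gamma> v = {}"
  defines "A \<equiv> adjacency_matrix \<Gamma>"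
    and "A' \<equiv> adjacency_matrix (alpha_transform \<Gamma> u v)"
  shows "A' $ u $ u = 0" and "A' $ v $ v = 0" and "A' $ u $ v = A $ u $ v"
    and "\<And>b. b \<notin> {u, v} \<Longrightarrow> A' $ u $ b = A $ u $ b + A $ v $ b"
    and "\<And>b. b \<notin> {u, v} \<Longrightarrow> A' $ v $ b = 0"
    and "\<And>a b. a \<notin> {u, v} \<Longrightarrow> b \<notin> {u, v} \<Longrightarrow> A' $ a $ b = A $ a $ b"
proof -
  have loop: "{a} \<notin> edges \<Gamma>" for a
    using sg unfolding signed_graph_def by fastforce
  then have uv': "u \<noteq> v" using uv by auto
  define N where "N = neighbours \<Gamma> v - {u}"
  have N: "u \<notin> N" "v \<notin> N"
    using loop[of v] by (auto simp: N_def neighbours_def)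
  have nu: "{u, b} \<notin> edges \<Gamma>" if "b \<in> N" for b
    using that disj by (auto simp: N_def neighbours_def)
  have memN: "b \<in> N \<longleftrightarrow> {v, b} \<in> edges \<Gamma>" if "b \<noteq> u" for b
    using that by (auto simp: N_def neighbours_def)
  have star: "{a, b} \<in> (\<lambda>w. {c, w}) ` N \<longleftrightarrow> a = c \<and> b \<in> N \<or> b = c \<and> a \<in> N" for a b c
    by (auto simp: doubleton_eq_iff)
  have entry: "A' $ a $ b =
      (if {a, b} \<in> (\<lambda>w. {u, w}) ` N then real_of_int (sign \<Gamma> (insert v ({a, b} - {u})))
       else if {a, b} \<in> edges \<Gamma> - (\<lambda>w. {v, w}) ` N then real_of_int (sign \<Gamma> {a, b}) else 0)"
    for a b
    unfolding A'_def adjacency_matrix_def alpha_transform_def Let_def N_def by auto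
  have A: "A $ a $ b = (if {a, b} \<in> edges \<Gamma> then real_of_int (sign \<Gamma> {a, b}) else 0)" for a b
    by (simp add: A_def adjacency_matrix_def)
  show "A' $ u $ u = 0" "A' $ v $ v = 0" "A' $ u $ v = A $ u $ v"
    using N loop uv' by (auto simp: entry A star)
  show "A' $ u $ b = A $ u $ b + A $ v $ b" if "b \<notin> {u, v}" for b
  proof -
    have "insert v ({u, b} - {u}) = {v, b}" using that by auto
    then show ?thesis
      using that N uv' nu[of b] memN[of b] by (auto simp: entry A star)
  qed
  show "A' $ v $ b = 0" if "b \<notin> {u, v}" for b
    using that N uv' memN[of b] by (auto simp: entry star)
  show "A' $ a $ b = A $ a $ b" if "a \<notin> {u, v}" "b \<notin> {u, v}" for a b
    using that by (auto simp: entry A star)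
qed

section \<open>The comparison vector for the transform\<close>

theorem corollary2p2:
  fixes \<Gamma> :: "('v::finite) sgraph" and u v :: 'v
  assumes "signed_graph \<Gamma>"
    and "graph_connected \<Gamma>"
    and "non_pendant_edge \<Gamma> {u, v}"
    and "cut_edge \<Gamma> {u, v}"
  shows "index (alpha_transform \<Gamma> u v) \<ge> index \<Gamma>"
proof (rule index_mono_rayleigh)
  fix x :: "real ^ 'v"
  define A where "A = adjacency_matrix \<Gamma>"
  define A' where "A' = adjacency_matrix (alpha_transform \<Gamma> u v)"
  let ?R = "- {u, v}"
  have uvE: "{u, v} \<in> edges \<Gamma>" using assms(4) by (simp add: cut_edge_def)
  have loop: "{a} \<notin> edges \<Gamma>" for a
    using assms(1) unfolding signed_graph_def by fastforce
  then have uv: "u \<noteq> v" using uvE by auto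
  obtain C where C: "v \<in> C" "u \<notin> C"
    "\<And>a b. {a, b} \<in> edges \<Gamma> \<Longrightarrow> {a, b} \<noteq> {u, v} \<Longrightarrow> a \<in> C \<longleftrightarrow> b \<in> C"
    using cut_edge_sides[OF assms(2,4)] by blast
  have A0: "A $ a $ b = 0" if "(a \<in> C) \<noteq> (b \<in> C)" "{a, b} \<noteq> {u, v}" for a b
    using that C(3)[of a b] by (auto simp: A_def adjacency_matrix_def)
  have Adiag: "A $ a $ a = 0" for a
    using loop by (simp add: A_def adjacency_matrix_def)
  \<comment> \<open>A common neighbour would lie on the side of \<open>u\<close> and on the side of
    \<open>v\<close> at once.\<close>
  have False if "{u, w} \<in> edges \<Gamma>" "{v, w} \<in> edges \<Gamma>" for w
  proof -
    have "w \<noteq> u" "w \<noteq> v" using that loop by auto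
    then show False using C that by (metis doubleton_eq_iff)
  qed
  then have "neighbours \<Gamma> u \<inter> neighbours \<Gamma> v = {}" by (auto simp: neighbours_def)
  note A' = adjacency_alpha_transform[OF assms(1) uvE this, folded A_def A'_def]
  define S where "S = (\<Sum>b\<in>?R. A $ u $ b * x $ b)"
  define T where "T = (\<Sum>b\<in>?R. A $ v $ b * x $ b)"
  obtain p q e d where pq: "e * e = 1" "d * d = 1"
      "p * p + q * q = x $ u * x $ u + x $ v * x $ v"
    and le: "A $ u $ v * x $ u * x $ v + x $ u * S + x $ v * T
      \<le> A $ u $ v * p * q + p * (e * S + d * T)"
    using exists_dominating_pair by blast
  define f where "f a = (if a \<in> C then d else e)" for a
  define y :: "real ^ 'v" where
    "y = (\<chi> a. if a = u then p else if a = v then q else f a * x $ a)"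
  have y: "y $ u = p" "y $ v = q" "\<And>a. a \<in> ?R \<Longrightarrow> y $ a = f a * x $ a"
    using uv by (auto simp: y_def)
  have ff: "f a * f a = 1" for a using pq by (simp add: f_def)
  have "y \<bullet> y = x \<bullet> x"
  proof -
    have "(\<Sum>a\<in>?R. y $ a * y $ a) = (\<Sum>a\<in>?R. x $ a * x $ a)"
    proof (intro sum.cong refl)
      fix a assume "a \<in> ?R"
      then have "y $ a * y $ a = (f a * f a) * (x $ a * x $ a)" by (simp add: y(3) mult_ac)
      then show "y $ a * y $ a = x $ a * x $ a" by (simp add: ff)
    qed
    then show ?thesis
      by (simp add: inner_vec_def sum_UNIV_split2[OF uv] y(1,2) pq(3))
  qed
  moreover have "x \<bullet> (A *v x) \<le> y \<bullet> (A' *v y)"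
  proof -
    have "(\<Sum>a\<in>?R. \<Sum>b\<in>?R. A' $ a $ b * y $ a * y $ b)
        = (\<Sum>a\<in>?R. \<Sum>b\<in>?R. A $ a $ b * x $ a * x $ b)"
    proof (intro sum.cong refl)
      fix a b assume ab: "a \<in> ?R" "b \<in> ?R"
      have "A' $ a $ b * y $ a * y $ b = A $ a $ b * (f a * f b) * (x $ a * x $ b)"
        using ab A'(6) by (simp add: y(3) mult_ac)
      \<comment> \<open>On one side the two signs multiply to 1; across the sides the entry is
        0.\<close>
      also have "A $ a $ b * (f a * f b) = A $ a $ b"
        using A0[of a b] ab ff[of a] by (cases "(a \<in> C) = (b \<in> C)") (auto simp: f_def doubleton_eq_iff)
      finally show "A' $ a $ b * y $ a * y $ b = A $ a $ b * x $ a * x $ b" by simp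
    qed
    moreover have "(\<Sum>b\<in>?R. A' $ u $ b * y $ b) = e * S + d * T"
    proof -
      \<comment> \<open>At most one of the two old entries is nonzero: the one for the end on the
        side of \<open>b\<close>, whose sign \<open>f b\<close> is the matching coefficient.\<close>
      have "A' $ u $ b * y $ b = e * (A $ u $ b * x $ b) + d * (A $ v $ b * x $ b)"
        if b: "b \<in> ?R" for b
      proof (cases "b \<in> C")
        case True
        then have "A $ u $ b = 0" using A0[of u b] C b by (auto simp: doubleton_eq_iff)
        then show ?thesis using True b A'(4)[of b] by (simp add: y(3) f_def)
      next
        case False
        then have "A $ v $ b = 0" using A0[of v b] C b by (auto simp: doubleton_eq_iff)
        then show ?thesis using False b A'(4)[of b] by (simp add: y(3) f_def)
      qed
      then show ?thesis by (simp add: S_def T_def sum_distrib_left sum.distrib)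
    qed
    \<comment> \<open>After the transform \<open>v\<close> is adjacent to \<open>u\<close> alone, so
      \<open>q\<close> enters the form only through \<open>uv\<close>.\<close>
    moreover have "(\<Sum>b\<in>?R. A' $ v $ b * y $ b) = 0"
      using A'(5) by simp
    moreover have "transpose A = A" "transpose A' = A'"
      by (simp_all add: A_def A'_def)
    ultimately show ?thesis
      using le
      by (simp add: quadratic_form_split2[OF uv] Adiag A'(1-3) y(1,2) flip: S_def T_def)
  qed
  ultimately show "\<exists>y. y \<bullet> y = x \<bullet> x \<and>
      x \<bullet> (adjacency_matrix \<Gamma> *v x) \<le> y \<bullet> (adjacency_matrix (alpha_transform \<Gamma> u v) *v y)"
    unfolding A_def A'_def by blast
qed

end
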